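(* Let $p\in(0,\infty]$, $q\in(0,\infty]$ and let $b$ be a slowly varying function. Then the Lorentz--Karamata functional $\lVert\cdot\rVert_{p,q,b}$ is a rearrangement-invariant quasi-Banach function norm on $M(R,\mu)$ (and consequently $(L^{p,q,b},\lVert\cdot\rVert_{p,q,b})$ is a rearrangement-invariant quasi-Banach function space) if and only if one of the following conditions holds: (i) $p<\infty$; (ii) $p=\infty$ and $\lVert t^{-1/q}b(t)\chi_{(0,1)}(t)\rVert_q<\infty$. Furthermore, if neither condition is satisfied, then $L^{p,q,b}=\{0\}$.
   Context: $(R,\mu)$ is a $\sigma$-finite non-atomic measure space with $\mu(R)=\infty$; $M=M(R,\mu)$ is the set of extended complex-valued $\mu$-measurable functions on $R$ (identified when equal $\mu$-a.e.), $M_+$ its non-negative elements. The non-increasing rearrangement of $f\in M$ is $f^*(t)=\inf\{s\ge 0:\mu(\{|f|>s\})\le t\}$, $t\ge 0$. Convention: $1/\infty=0$. A measurable $b:(0,\infty)\to(0,\infty)$ is slowly varying if for every $\varepsilon>0$ there are a non-decreasing function $b_\varepsilon$ and a non-increasing function $b_{-\varepsilon}$ with $t^\varepsilon b(t)\approx b_\varepsilon(t)$ and $t^{-\varepsilon}b(t)\approx b_{-\varepsilon}(t)$ on $(0,\infty)$, where $\approx$ denotes two-sided estimate up to positive finite multiplicative constants. For $f\in M$, $\lVert f\rVert_{p,q,b}=\lVert t^{1/p-1/q}b(t)f^*(t)\rVert_q$, where $\lVert\cdot\rVert_q$ is the Lebesgue $L^q$ (quasi)norm over $(0,\infty)$ with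 Lebesgue measure (in the variable $t$), and $L^{p,q,b}=\{f\in M:\lVert f\rVert_{p,q,b}<\infty\}$. A functional $\lVert\cdot\rVert:M\to[0,\infty]$ with $\lVert f\rVert=\lVert\,|f|\,\rVert$ is a rearrangement-invariant quasi-Banach function norm if on $M_+$: (Q1) it is positively homogeneous, $\lVert f\rVert=0\iff f=0$ a.e., and there is $C<\infty$ with $\lVert f+g\rVert\le C(\lVert f\rVert+\lVert g\rVert)$; (P2) $f\le g$ a.e. implies $\lVert f\rVert\le\lVert g\rVert$; (P3) $f_n\uparrow f$ a.e. implies $\lVert f_n\rVert\uparrow\lVert f\rVert$; (P4) $\lVert\chi_E\rVert<\infty$ whenever $\mu(E)<\infty$; (P6) $f^*=g^*$ implies $\lVert f\rVert=\lVert g\rVert$. The corresponding space $\{f:\lVert f\rVert<\infty\}$ is called a rearrangement-invariant quasi-Banach function space. *)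

theory Defs
  imports "HOL-Analysis.Analysis" "HOL-Probability.Essential_Supremum"
begin

section \<open>Measurable functions with extended complex values\<close>

text \<open>Extended complex numbers form the one-point compactification of the complex plane;
  \<open>None\<close> is the point at infinity.\<close>

type_synonym ecomplex = "complex option"

definition ecomplex_borel :: "ecomplex measure" where
  "ecomplex_borel = sigma UNIV {U. openin (Alexandroff_compactification euclidean) U}"

definition ecmod :: "ecomplex \<Rightarrow> ennreal" where
  "ecmod z = (case z of None \<Rightarrow> \<infinity> | Some w \<Rightarrow> ennreal (cmod w))"

definition ecomplex_of_ennreal :: "ennreal \<Rightarrow> ecomplex" where
  "ecomplex_of_ennreal x = (if x = \<infinity> then None else Some (complex_of_real (enn2real x)))"

text \<open>Functions are not quotiented by a.e. equality; the axioms and statements below are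
  phrased a.e. instead. The cone \<open>M_+\<close> consists of the Borel functions into \<open>ennreal\<close>,
  on which a functional on \<open>M\<close> acts through the inclusion of \<open>[0,\<infinity>]\<close>.\<close>

abbreviation M_fun :: "'a measure \<Rightarrow> ('a \<Rightarrow> ecomplex) set" where
  "M_fun M \<equiv> M \<rightarrow>\<^sub>M ecomplex_borel"

abbreviation M_plus :: "'a measure \<Rightarrow> ('a \<Rightarrow> ennreal) set" where
  "M_plus M \<equiv> borel_measurable M"

abbreviation to_M :: "('a \<Rightarrow> ennreal) \<Rightarrow> 'a \<Rightarrow> ecomplex" where
  "to_M f \<equiv> \<lambda>x. ecomplex_of_ennreal (f x)"

definition non_atomic :: "'a measure \<Rightarrow> bool" where
  "non_atomic M \<longleftrightarrow> (\<forall>A\<in>sets M. 0 < emeasure M A \<longrightarrow>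
     (\<exists>B\<in>sets M. B \<subseteq> A \<and> 0 < emeasure M B \<and> emeasure M B < emeasure M A))"

definition rearrangement :: "'a measure \<Rightarrow> ('a \<Rightarrow> ecomplex) \<Rightarrow> real \<Rightarrow> ennreal" where
  "rearrangement M f t =
     Inf {ennreal s | s. 0 \<le> s \<and> emeasure M {x \<in> space M. ecmod (f x) > ennreal s} \<le> ennreal t}"

section \<open>Rearrangement-invariant quasi-Banach function norms\<close>

definition ri_quasi_Banach_function_norm ::
  "'a measure \<Rightarrow> (('a \<Rightarrow> ecomplex) \<Rightarrow> ennreal) \<Rightarrow> bool" where
  "ri_quasi_Banach_function_norm M N \<longleftrightarrow>
     (\<forall>f\<in>M_fun M. N f = N (to_M (\<lambda>x. ecmod (f x)))) \<and>
     (\<forall>f\<in>M_plus M. \<forall>a::real. a \<ge> 0 \<longrightarrow> N (to_M (\<lambda>x. ennreal a * f x)) = ennreal a * N (to_M f)) \<and>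
     (\<forall>f\<in>M_plus M. N (to_M f) = 0 \<longleftrightarrow> (AE x in M. f x = 0)) \<and>
     (\<exists>C<\<infinity>. \<forall>f\<in>M_plus M. \<forall>g\<in>M_plus M.
        N (to_M (\<lambda>x. f x + g x)) \<le> C * (N (to_M f) + N (to_M g))) \<and>
     (\<forall>f\<in>M_plus M. \<forall>g\<in>M_plus M. (AE x in M. f x \<le> g x) \<longrightarrow> N (to_M f) \<le> N (to_M g)) \<and>
     (\<forall>F f. (\<forall>n::nat. F n \<in> M_plus M) \<longrightarrow> f \<in> M_plus M \<longrightarrow>
        (AE x in M. incseq (\<lambda>n. F n x) \<and> (\<lambda>n. F n x) \<longlonglongrightarrow> f x) \<longrightarrow>
        incseq (\<lambda>n. N (to_M (F n))) \<and> (\<lambda>n. N (to_M (F n))) \<longlonglongrightarrow> N (to_M f)) \<and>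
     (\<forall>E\<in>sets M. emeasure M E < \<infinity> \<longrightarrow> N (to_M (indicator E)) < \<infinity>) \<and>
     (\<forall>f\<in>M_plus M. \<forall>g\<in>M_plus M.
        (\<forall>t\<ge>0. rearrangement M (to_M f) t = rearrangement M (to_M g) t) \<longrightarrow>
        N (to_M f) = N (to_M g))"

definition ri_quasi_Banach_function_space ::
  "'a measure \<Rightarrow> ('a \<Rightarrow> ecomplex) set \<Rightarrow> (('a \<Rightarrow> ecomplex) \<Rightarrow> ennreal) \<Rightarrow> bool" where
  "ri_quasi_Banach_function_space M X N \<longleftrightarrow>
     ri_quasi_Banach_function_norm M N \<and> X = {f \<in> M_fun M. N f < \<infinity>}"

section \<open>Lorentz--Karamata functionals\<close>

text \<open>Only the values of \<open>b\<close> on \<open>(0,\<infinity>)\<close> matter, in all definitions below.\<close>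

definition equiv_pos :: "(real \<Rightarrow> real) \<Rightarrow> (real \<Rightarrow> real) \<Rightarrow> bool" where
  "equiv_pos f g \<longleftrightarrow> (\<exists>c>0. \<exists>C>0. \<forall>t>0. c * g t \<le> f t \<and> f t \<le> C * g t)"

definition slowly_varying :: "(real \<Rightarrow> real) \<Rightarrow> bool" where
  "slowly_varying b \<longleftrightarrow>
     b \<in> borel_measurable (lebesgue_on {0<..}) \<and> (\<forall>t>0. 0 < b t) \<and>
     (\<forall>\<epsilon>>0. (\<exists>b1. mono_on {0<..} b1 \<and> equiv_pos (\<lambda>t. t powr \<epsilon> * b t) b1) \<and>
             (\<exists>b2. antimono_on {0<..} b2 \<and> equiv_pos (\<lambda>t. t powr (-\<epsilon>) * b t) b2))"

text \<open>Powers of elements of \<open>[0,\<infinity>]\<close>, intended for exponents \<open>r > 0\<close> only.\<close>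

definition ennpowr :: "ennreal \<Rightarrow> real \<Rightarrow> ennreal" where
  "ennpowr x r = (if x = \<infinity> then \<infinity> else ennreal (enn2real x powr r))"

text \<open>The reciprocal of an exponent in \<open>(0,\<infinity>]\<close>, with \<open>1/\<infinity> = 0\<close>.\<close>

abbreviation recip :: "ennreal \<Rightarrow> real" where
  "recip p \<equiv> enn2real (1 / p)"

definition Lq_norm :: "ennreal \<Rightarrow> (real \<Rightarrow> ennreal) \<Rightarrow> ennreal" where
  "Lq_norm q g =
     (if q = \<infinity> then esssup (lebesgue_on {0<..}) g
      else ennpowr (\<integral>\<^sup>+t. ennpowr (g t) (enn2real q) \<partial>lebesgue_on {0<..}) (recip q))"

definition LK_norm ::
  "'a measure \<Rightarrow> ennreal \<Rightarrow> ennreal \<Rightarrow> (real \<Rightarrow> real) \<Rightarrow> ('a \<Rightarrow> ecomplex) \<Rightarrow> ennreal" where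
  "LK_norm M p q b f =
     Lq_norm q (\<lambda>t. ennreal (t powr (recip p - recip q) * b t) * rearrangement M f t)"

definition LK_space ::
  "'a measure \<Rightarrow> ennreal \<Rightarrow> ennreal \<Rightarrow> (real \<Rightarrow> real) \<Rightarrow> ('a \<Rightarrow> ecomplex) set" where
  "LK_space M p q b = {f \<in> M_fun M. LK_norm M p q b f < \<infinity>}"

end

theory Submission
  imports Defs
begin

text \<open>The rearrangement satisfies \<open>f\<^sup>*(t) \<le> s\<close> iff \<open>\<mu>{|f| > s} \<le> t\<close>. This equivalence gives
  monotonicity, the Fatou property, homogeneity and \<open>(f+g)\<^sup>*(t) \<le> f\<^sup>*(t/2) + g\<^sup>*(t/2)\<close>. As the weight
  \<open>t\<^bsup>1/p-1/q\<^esup> b(t)\<close> changes at most by a constant factor when \<open>t\<close> is halved, all axioms except (P4)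
  hold for every \<open>p\<close>, \<open>q\<close> and \<open>b\<close>. Axiom (P4) says that the weight has finite
  \<open>L\<^sup>q\<close> norm on every bounded interval \<open>(0,m)\<close>, which only depends on the behaviour at \<open>0\<close> and
  is automatic for \<open>p < \<infinity>\<close>. If it fails, no \<open>f \<noteq> 0\<close> has finite norm, since \<open>f\<^sup>*\<close> is bounded
  below by a positive constant near \<open>0\<close>.\<close>

section \<open>Powers in the extended half-line\<close>

lemma ennpowr_ennreal: "0 \<le> x \<Longrightarrow> ennpowr (ennreal x) r = ennreal (x powr r)"
  by (simp add: ennpowr_def)

lemma ennpowr_top [simp]: "ennpowr top r = top"
  by (simp add: ennpowr_def)

lemma ennpowr_0 [simp]: "ennpowr 0 r = 0"
  by (simp add: ennpowr_def)

text \<open>No sign condition on \<open>r\<close>: the value at infinity is infinite by definition,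
  even for \<open>r = 0\<close>. The exponent \<open>recip q\<close> is indeed 0 for infinite
  \<open>q\<close>.\<close>

lemma ennpowr_less_top_iff: "ennpowr x r < top \<longleftrightarrow> x < top"
  by (simp add: ennpowr_def less_top)

lemma ennpowr_eq_0_iff: "ennpowr x r = 0 \<longleftrightarrow> x = 0"
  by (cases x) (auto simp: ennpowr_def)

lemma ennpowr_mono: "0 \<le> r \<Longrightarrow> x \<le> y \<Longrightarrow> ennpowr x r \<le> ennpowr y r"
  by (cases x; cases y) (auto simp: ennpowr_def top_unique intro!: ennreal_leI powr_mono2)

lemma ennpowr_ennpowr: "ennpowr (ennpowr x r) s = ennpowr x (r * s)"
  by (cases x) (auto simp: ennpowr_def powr_powr)

lemma ennpowr_1 [simp]: "ennpowr x 1 = x"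
  by (cases x) (auto simp: ennpowr_def)

lemma ennpowr_mult:
  assumes "0 < r"
  shows "ennpowr (x * y) r = ennpowr x r * ennpowr y r"
  using assms
  by (cases x; cases y)
     (auto simp: ennpowr_def ennreal_mult_eq_top_iff powr_mult ennreal_mult ennreal_mult_top ennreal_top_mult
       simp flip: ennreal_mult)

text \<open>The maps x -> x^(1/r) and y -> y^r are mutually inverse and monotone, so each is adjoint
  to the other. This removes the outer root in an L^q norm: a bound on the norm becomes a bound on
  the integral.\<close>

lemma ennpowr_le_iff:
  assumes "0 < r"
  shows "ennpowr x (1 / r) \<le> y \<longleftrightarrow> x \<le> ennpowr y r"
proof
  assume "ennpowr x (1 / r) \<le> y"
  then have "ennpowr (ennpowr x (1 / r)) r \<le> ennpowr y r"
    using assms by (intro ennpowr_mono) auto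
  then show "x \<le> ennpowr y r" using assms by (simp add: ennpowr_ennpowr)
next
  assume "x \<le> ennpowr y r"
  then have "ennpowr x (1 / r) \<le> ennpowr (ennpowr y r) (1 / r)"
    using assms by (intro ennpowr_mono) auto
  then show "ennpowr x (1 / r) \<le> y" using assms by (simp add: ennpowr_ennpowr)
qed

text \<open>By \<open>ennpowr_le_iff\<close> the power map is a left adjoint, and left adjoints
  commute with suprema.\<close>

lemma ennpowr_SUP:
  assumes "0 < r"
  shows "ennpowr (SUP i\<in>I. x i) r = (SUP i\<in>I. ennpowr (x i) r)"
proof -
  have *: "ennpowr z r \<le> y \<longleftrightarrow> z \<le> ennpowr y (1 / r)" for z y
    using ennpowr_le_iff[of "1 / r" z y] assms by simp
  show ?thesis
  proof (rule antisym)
    show "ennpowr (SUP i\<in>I. x i) r \<le> (SUP i\<in>I. ennpowr (x i) r)"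
      unfolding * SUP_le_iff by (auto simp flip: * intro: SUP_upper)
    show "(SUP i\<in>I. ennpowr (x i) r) \<le> ennpowr (SUP i\<in>I. x i) r"
      using assms by (auto intro!: SUP_least ennpowr_mono SUP_upper)
  qed
qed

text \<open>Comparing the sum with twice the maximum treats r < 1 and r >= 1 alike.\<close>

lemma ennpowr_add_le:
  assumes "0 < r"
  shows "ennpowr (x + y) r \<le> ennreal (2 powr r) * (ennpowr x r + ennpowr y r)"
proof -
  have "ennpowr (x + y) r \<le> ennpowr (2 * max x y) r"
    using assms by (intro ennpowr_mono) (auto simp: mult_2 intro!: add_mono)
  also have "\<dots> = ennreal (2 powr r) * ennpowr (max x y) r"
    using assms ennpowr_ennreal[of 2 r] by (simp add: ennpowr_mult)
  also have "\<dots> \<le> ennreal (2 powr r) * (ennpowr x r + ennpowr y r)"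
    by (intro mult_left_mono) (auto simp: max_def)
  finally show ?thesis .
qed

lemma borel_measurable_ennpowr [measurable (raw)]:
  assumes [measurable]: "g \<in> borel_measurable N"
  shows "(\<lambda>x. ennpowr (g x) r) \<in> borel_measurable N"
  unfolding ennpowr_def by measurable

lemma recip_eq: "0 < q \<Longrightarrow> q \<noteq> \<infinity> \<Longrightarrow> recip q = 1 / enn2real q"
  by (cases q) (auto simp: divide_ennreal simp flip: ennreal_1)

lemma enn2real_exponent_pos: "0 < (q::ennreal) \<Longrightarrow> q \<noteq> \<infinity> \<Longrightarrow> 0 < enn2real q"
  by (simp add: enn2real_positive_iff less_top)

section \<open>Lebesgue quasinorms on the half-line\<close>

abbreviation half_line :: "real measure" where
  "half_line \<equiv> lebesgue_on {0<..}"

text \<open>Describing the norm by its upper bounds makes it enough, in most later estimates, to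
  check a pointwise bound or a bound on an integral.\<close>

lemma Lq_norm_le_iff:
  assumes "0 < q" and [measurable]: "g \<in> borel_measurable half_line"
  shows "Lq_norm q g \<le> K \<longleftrightarrow>
    (if q = \<infinity> then AE t in half_line. g t \<le> K
     else (\<integral>\<^sup>+t. ennpowr (g t) (enn2real q) \<partial>half_line) \<le> ennpowr K (enn2real q))"
proof (cases "q = \<infinity>")
  case True
  have "AE t in half_line. g t \<le> K" if "esssup half_line g \<le> K"
    using esssup_AE[where f=g and M=half_line] that by (auto elim!: eventually_mono)
  with True show ?thesis by (auto simp: Lq_norm_def intro!: esssup_I)
next
  case False
  then show ?thesis
    using assms by (simp add: Lq_norm_def recip_eq ennpowr_le_iff enn2real_exponent_pos)
qed

text \<open>For infinite \<open>q\<close>, \<open>esssup\<close> of a non-measurable function is top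
  by convention, so measurability is only asked of the smaller function.\<close>

lemma Lq_norm_mono:
  assumes "0 < q" and "g \<in> borel_measurable half_line" and "AE t in half_line. g t \<le> h t"
  shows "Lq_norm q g \<le> Lq_norm q h"
  using assms unfolding Lq_norm_def
  by (auto intro!: esssup_AE_mono ennpowr_mono nn_integral_mono_AE elim!: eventually_mono)

text \<open>The case \<open>K = 0\<close> of \<open>Lq_norm_le_iff\<close>.\<close>

lemma Lq_norm_eq_0_iff:
  assumes "0 < q" and [measurable]: "g \<in> borel_measurable half_line"
  shows "Lq_norm q g = 0 \<longleftrightarrow> (AE t in half_line. g t = 0)"
  unfolding le_zero_eq[symmetric] Lq_norm_le_iff[OF assms]
  by (auto simp: nn_integral_0_iff_AE ennpowr_eq_0_iff)

lemma Lq_norm_cmult_le: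
  assumes "0 < q" and [measurable]: "g \<in> borel_measurable half_line"
  shows "Lq_norm q (\<lambda>t. c * g t) \<le> c * Lq_norm q g"
proof (cases "q = \<infinity>")
  case True
  have "AE t in half_line. g t \<le> Lq_norm q g"
    using Lq_norm_le_iff[OF assms, of "Lq_norm q g"] True by simp
  then show ?thesis using True assms(1)
    by (subst Lq_norm_le_iff) (auto elim!: eventually_mono intro: mult_left_mono)
next
  case False
  then have q: "0 < enn2real q" using assms(1) by (rule enn2real_exponent_pos[rotated])
  have "(\<integral>\<^sup>+t. ennpowr (g t) (enn2real q) \<partial>half_line) \<le> ennpowr (Lq_norm q g) (enn2real q)"
    using Lq_norm_le_iff[OF assms, of "Lq_norm q g"] False by simp
  then show ?thesis using False assms(1) q
    by (subst Lq_norm_le_iff) (auto simp: ennpowr_mult nn_integral_cmult intro: mult_left_mono)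
qed

text \<open>The missing inequality is \<open>Lq_norm_cmult_le\<close> applied to c g with the scalar
  1/c.\<close>

lemma Lq_norm_cmult:
  assumes "0 < q" and [measurable]: "g \<in> borel_measurable half_line" and "0 < c"
  shows "Lq_norm q (\<lambda>t. ennreal c * g t) = ennreal c * Lq_norm q g"
proof (rule antisym[OF Lq_norm_cmult_le[OF assms(1,2)]])
  have inv: "ennreal c * (ennreal (1 / c) * x) = x" "ennreal (1 / c) * (ennreal c * x) = x" for x
    using assms(3) by (simp_all add: mult.assoc[symmetric] flip: ennreal_mult)
  have "Lq_norm q (\<lambda>t. ennreal (1 / c) * (ennreal c * g t)) \<le> ennreal (1 / c) * Lq_norm q (\<lambda>t. ennreal c * g t)"
    using assms(1) by (intro Lq_norm_cmult_le) auto
  then have "ennreal c * Lq_norm q g \<le> ennreal c * (ennreal (1 / c) * Lq_norm q (\<lambda>t. ennreal c * g t))"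
    by (intro mult_left_mono) (auto simp: inv)
  then show "ennreal c * Lq_norm q g \<le> Lq_norm q (\<lambda>t. ennreal c * g t)"
    by (simp add: inv)
qed

lemma Lq_norm_add:
  assumes "0 < q"
  obtains C where "C < \<infinity>" and "\<And>g h. g \<in> borel_measurable half_line \<Longrightarrow> h \<in> borel_measurable half_line \<Longrightarrow>
    Lq_norm q (\<lambda>t. g t + h t) \<le> C * (Lq_norm q g + Lq_norm q h)"
proof (cases "q = \<infinity>")
  case True
  have "Lq_norm q (\<lambda>t. g t + h t) \<le> 1 * (Lq_norm q g + Lq_norm q h)"
    if [measurable]: "g \<in> borel_measurable half_line" "h \<in> borel_measurable half_line" for g h
  proof -
    have "AE t in half_line. g t \<le> Lq_norm q g" "AE t in half_line. h t \<le> Lq_norm q h"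
      using Lq_norm_le_iff[OF assms that(1), of "Lq_norm q g"]
        Lq_norm_le_iff[OF assms that(2), of "Lq_norm q h"] True by simp_all
    then have "AE t in half_line. g t + h t \<le> Lq_norm q g + Lq_norm q h"
      by eventually_elim (rule add_mono)
    then show ?thesis using True assms by (subst Lq_norm_le_iff) auto
  qed
  then show ?thesis by (intro that[of 1]) auto
next
  case False
  then have q: "0 < enn2real q" using assms by (rule enn2real_exponent_pos[rotated])
  let ?r = "enn2real q"
  \<comment> \<open>The r-th power of this constant is 2^r * 2: the factor 2^r comes from
    \<open>ennpowr_add_le\<close>, the factor 2 from bounding each of the two integrals by the r-th
    power of the same number \<open>?S\<close>.\<close>
  have "Lq_norm q (\<lambda>t. g t + h t) \<le> 2 * ennpowr 2 (1 / ?r) * (Lq_norm q g + Lq_norm q h)"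
    if [measurable]: "g \<in> borel_measurable half_line" "h \<in> borel_measurable half_line" for g h
  proof -
    let ?S = "Lq_norm q g + Lq_norm q h"
    have "Lq_norm q g \<le> ?S" "Lq_norm q h \<le> ?S" by auto
    then have *: "(\<integral>\<^sup>+t. ennpowr (g t) ?r \<partial>half_line) \<le> ennpowr ?S ?r"
      "(\<integral>\<^sup>+t. ennpowr (h t) ?r \<partial>half_line) \<le> ennpowr ?S ?r"
      using Lq_norm_le_iff[OF assms that(1), of ?S] Lq_norm_le_iff[OF assms that(2), of ?S] False
      by simp_all
    have "(\<integral>\<^sup>+t. ennpowr (g t + h t) ?r \<partial>half_line)
      \<le> (\<integral>\<^sup>+t. ennreal (2 powr ?r) * (ennpowr (g t) ?r + ennpowr (h t) ?r) \<partial>half_line)"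
      by (intro nn_integral_mono ennpowr_add_le q)
    also have "\<dots> = ennreal (2 powr ?r) *
        ((\<integral>\<^sup>+t. ennpowr (g t) ?r \<partial>half_line) + (\<integral>\<^sup>+t. ennpowr (h t) ?r \<partial>half_line))"
      by (simp add: nn_integral_cmult nn_integral_add)
    also have "\<dots> \<le> ennreal (2 powr ?r) * (ennpowr ?S ?r + ennpowr ?S ?r)"
      by (intro mult_left_mono add_mono *) auto
    also have "\<dots> = ennpowr (2 * ennpowr 2 (1 / ?r) * ?S) ?r"
      using q ennpowr_ennreal[of 2 ?r] by (simp add: ennpowr_mult ennpowr_ennpowr ac_simps flip: mult_2)
    finally show ?thesis using assms False by (subst Lq_norm_le_iff) auto
  qed
  moreover have "2 * ennpowr 2 (1 / ?r) < \<infinity>"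
    using ennpowr_less_top_iff[of 2 "1 / ?r"] by (simp add: ennreal_mult_less_top)
  ultimately show ?thesis using that by blast
qed

text \<open>For finite \<open>q\<close> this is monotone convergence, as the power commutes with
  suprema. For infinite \<open>q\<close> the countably many exceptional null sets are
  united.\<close>

lemma Lq_norm_SUP:
  fixes G :: "nat \<Rightarrow> real \<Rightarrow> ennreal"
  assumes "0 < q" and G [measurable]: "\<And>n. G n \<in> borel_measurable half_line"
    and "\<And>t. incseq (\<lambda>n. G n t)"
  shows "Lq_norm q (\<lambda>t. SUP n. G n t) = (SUP n. Lq_norm q (G n))"
proof (rule antisym)
  show "(SUP n. Lq_norm q (G n)) \<le> Lq_norm q (\<lambda>t. SUP n. G n t)"
    using assms(1) by (intro SUP_least Lq_norm_mono AE_I2) (auto intro: SUP_upper)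
  let ?S = "SUP n. Lq_norm q (G n)"
  have le: "Lq_norm q (G n) \<le> ?S" for n by (rule SUP_upper) simp
  show "Lq_norm q (\<lambda>t. SUP n. G n t) \<le> ?S"
  proof (cases "q = \<infinity>")
    case True
    then have "AE t in half_line. \<forall>n. G n t \<le> ?S"
      using le Lq_norm_le_iff[OF assms(1) G] by (simp add: AE_all_countable)
    then show ?thesis using True assms(1)
      by (subst Lq_norm_le_iff) (auto elim!: eventually_mono simp: SUP_le_iff)
  next
    case False
    then have q: "0 < enn2real q" using assms(1) by (rule enn2real_exponent_pos[rotated])
    have "(\<integral>\<^sup>+t. ennpowr (SUP n. G n t) (enn2real q) \<partial>half_line)
        = (SUP n. \<integral>\<^sup>+t. ennpowr (G n t) (enn2real q) \<partial>half_line)"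
      unfolding ennpowr_SUP[OF q] using assms(3) q
      by (intro nn_integral_monotone_convergence_SUP)
         (auto simp: incseq_def le_fun_def intro!: ennpowr_mono)
    also have "\<dots> \<le> ennpowr ?S (enn2real q)"
      using le Lq_norm_le_iff[OF assms(1) G] False by (auto intro!: SUP_least)
    finally show ?thesis using False assms(1) by (subst Lq_norm_le_iff) auto
  qed
qed

text \<open>Extension by zero to \<open>g'\<close> moves the claim to the whole line, where the
  affine change of variables applies.\<close>

lemma half_line_dilation:
  assumes "g \<in> borel_measurable half_line"
  shows borel_measurable_half_line_dilation: "(\<lambda>t. g (t / 2)) \<in> borel_measurable half_line"
    and nn_integral_half_line_dilation:
      "(\<integral>\<^sup>+t. g (t / 2) \<partial>half_line) = 2 * (\<integral>\<^sup>+t. g t \<partial>half_line)"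
proof -
  define g' :: "real \<Rightarrow> ennreal" where "g' t = g t * indicator {0<..} t" for t
  have g' [measurable]: "g' \<in> borel_measurable lebesgue"
    using assms unfolding g'_def by (subst (asm) borel_measurable_restrict_space_iff_ennreal) auto
  have g'_half: "g' (t / 2) = g (t / 2) * indicator {0<..} t" for t
    by (simp add: g'_def indicator_def)
  \<comment> \<open>As \<open>g'\<close> is only Lebesgue measurable, Borel measurability of the
    scaling would not suffice for the composition: preimages of null sets must be measurable as
    well.\<close>
  have "(\<lambda>t. (1/2) *\<^sub>R t :: real) \<in> lebesgue \<rightarrow>\<^sub>M lebesgue"
    by (rule lebesgue_measurable_scaling)
  from measurable_compose[OF this g'] have "(\<lambda>t. g' (t / 2)) \<in> borel_measurable lebesgue"
    by simp
  then show "(\<lambda>t. g (t / 2)) \<in> borel_measurable half_line"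
    by (subst borel_measurable_restrict_space_iff_ennreal) (auto simp flip: g'_half)
  have half: "2 * ennreal (1 / 2) = 1"
    using ennreal_mult[of 2 "1 / 2"] by simp
  have "(\<integral>\<^sup>+t. g (t / 2) \<partial>half_line) = (\<integral>\<^sup>+t. g' (t / 2) \<partial>lebesgue)"
    by (simp add: nn_integral_restrict_space g'_half)
  also have "\<dots> = 2 * (ennreal (1 / 2) * (\<integral>\<^sup>+t. g' (0 + (1/2) * t) \<partial>lebesgue))"
    unfolding mult.assoc[symmetric] half by simp
  also have "\<dots> = 2 * (\<integral>\<^sup>+t. g' t \<partial>lebesgue)"
    using nn_integral_real_affine_lebesgue[OF g', of "1/2" 0] by simp
  also have "(\<integral>\<^sup>+t. g' t \<partial>lebesgue) = (\<integral>\<^sup>+t. g t \<partial>half_line)"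
    by (simp add: nn_integral_restrict_space g'_def)
  finally show "(\<integral>\<^sup>+t. g (t / 2) \<partial>half_line) = 2 * (\<integral>\<^sup>+t. g t \<partial>half_line)" .
qed

text \<open>The integral doubles under the dilation, which gives the factor 2^(1/q). For infinite
  \<open>q\<close> this factor is 1.\<close>

lemma Lq_norm_dilation_le:
  assumes "0 < q" and g [measurable]: "g \<in> borel_measurable half_line"
  shows "Lq_norm q (\<lambda>t. g (t / 2)) \<le> ennpowr 2 (recip q) * Lq_norm q g"
proof (cases "q = \<infinity>")
  case True
  note [measurable] = borel_measurable_half_line_dilation[OF g]
  \<comment> \<open>To see that the dilated exceptional set is still null, the integral formula is
    applied to the indicator of that set.\<close>
  let ?bad = "\<lambda>t. indicator {t. Lq_norm q g < g t} t :: ennreal"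
  have "AE t in half_line. g t \<le> Lq_norm q g"
    using Lq_norm_le_iff[OF assms, of "Lq_norm q g"] True by simp
  then have "(\<integral>\<^sup>+t. ?bad t \<partial>half_line) = 0"
    by (subst nn_integral_0_iff_AE) (auto elim!: eventually_mono)
  then have "(\<integral>\<^sup>+t. ?bad (t / 2) \<partial>half_line) = 0"
    by (subst nn_integral_half_line_dilation) auto
  then have "AE t in half_line. ?bad (t / 2) = 0"
    by (subst (asm) nn_integral_0_iff_AE) (auto simp: indicator_def)
  then show ?thesis using True assms(1)
    by (subst Lq_norm_le_iff) (auto elim!: eventually_mono simp: ennpowr_def not_less indicator_def split: if_splits)
next
  case False
  then have q: "0 < enn2real q" using assms(1) by (rule enn2real_exponent_pos[rotated])
  note [measurable] = borel_measurable_half_line_dilation[OF g]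
  have "(\<integral>\<^sup>+t. ennpowr (g (t / 2)) (enn2real q) \<partial>half_line) =
    2 * (\<integral>\<^sup>+t. ennpowr (g t) (enn2real q) \<partial>half_line)"
    by (intro nn_integral_half_line_dilation) auto
  also have "\<dots> \<le> 2 * ennpowr (Lq_norm q g) (enn2real q)"
    using Lq_norm_le_iff[OF assms, of "Lq_norm q g"] False by (intro mult_left_mono) auto
  finally show ?thesis using False assms(1) q
    by (subst Lq_norm_le_iff) (auto simp: ennpowr_mult ennpowr_ennpowr recip_eq)
qed

section \<open>The non-increasing rearrangement\<close>

lemma ecmod_ecomplex_of_ennreal [simp]: "ecmod (ecomplex_of_ennreal x) = x"
  by (cases x) (auto simp: ecmod_def ecomplex_of_ennreal_def)

lemma ecmod_eq_0_iff: "ecmod z = 0 \<longleftrightarrow> z = Some 0"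
  by (auto simp: ecmod_def split: option.splits)

text \<open>For finite r the set {|z| > r} is the complement of a closed ball together with the
  point at infinity. The ball is compact, so the set is open in the compactification.\<close>

lemma borel_measurable_ecmod [measurable]: "ecmod \<in> borel_measurable ecomplex_borel"
proof (rule borel_measurableI_greater)
  fix y :: ennreal
  show "{z \<in> space ecomplex_borel. y < ecmod z} \<in> sets ecomplex_borel"
  proof (cases y)
    case (real r)
    have "{z \<in> space ecomplex_borel. y < ecmod z} = insert None (Some ` (UNIV - cball 0 r))"
    proof (rule set_eqI)
      fix z show "z \<in> {z \<in> space ecomplex_borel. y < ecmod z} \<longleftrightarrow> z \<in> insert None (Some ` (UNIV - cball 0 r))"
        using real by (cases z) (auto simp: ecomplex_borel_def ecmod_def ennreal_less_iff)
    qed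
    also have "openin (Alexandroff_compactification euclidean) \<dots>"
      unfolding openin_Alexandroff_compactification
      by (intro disjI2 exI[of _ "cball 0 r"]) (auto simp: compactin_euclidean_iff)
    finally show ?thesis by (simp add: ecomplex_borel_def)
  next
    case top
    then show ?thesis by simp
  qed
qed

text \<open>The infimum defining f* is attained when finite, by continuity of the measure from
  below. Nearly all facts on f* are read off from this equivalence.\<close>

lemma rearrangement_le_iff:
  assumes [measurable]: "(\<lambda>x. ecmod (f x)) \<in> borel_measurable M"
  shows "rearrangement M f t \<le> s \<longleftrightarrow> emeasure M {x \<in> space M. s < ecmod (f x)} \<le> ennreal t"
proof
  assume le: "rearrangement M f t \<le> s"
  show "emeasure M {x \<in> space M. s < ecmod (f x)} \<le> ennreal t"
  proof (cases "s = \<infinity>")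
    case False
    then obtain r where r: "0 \<le> r" "s = ennreal r" by (cases s) auto
    \<comment> \<open>Levels decreasing strictly to s. Each \<open>u n\<close> exceeds f*(t), so
      some admissible level lies below it; the sets {|f| > u n} increase to {|f| > s}.\<close>
    define u where "u n = ennreal (r + inverse (Suc n))" for n
    have "{x \<in> space M. s < ecmod (f x)} = (\<Union>n. {x \<in> space M. u n < ecmod (f x)})"
    proof -
      have "\<exists>n. u n < y" if "s < y" for y
      proof (cases y)
        case (real z)
        with that r have "0 < z - r" by (simp add: ennreal_less_iff)
        then obtain n where "inverse (Suc n) < z - r" using reals_Archimedean by blast
        with real r show ?thesis by (auto simp: u_def ennreal_less_iff simp del: ennreal_plus intro!: exI[of _ n])
      qed (simp add: u_def)
      moreover have "s < u n" for n using r by (simp add: u_def ennreal_less_iff)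
      ultimately show ?thesis by (blast intro: less_trans)
    qed
    also have "emeasure M \<dots> = (SUP n. emeasure M {x \<in> space M. u n < ecmod (f x)})"
    proof (rule SUP_emeasure_incseq[symmetric])
      have "u n \<le> u m" if "m \<le> n" for m n
        unfolding u_def using that by (intro ennreal_leI) (simp add: field_simps)
      then show "incseq (\<lambda>n. {x \<in> space M. u n < ecmod (f x)})"
        by (fastforce simp: incseq_def intro: le_less_trans)
    qed auto
    also have "\<dots> \<le> ennreal t"
    proof (rule SUP_least)
      fix n
      have "rearrangement M f t < u n"
        using le r by (auto simp: u_def ennreal_less_iff intro: le_less_trans)
      then obtain s' where "ennreal s' < u n" "emeasure M {x \<in> space M. ennreal s' < ecmod (f x)} \<le> ennreal t"
        unfolding rearrangement_def Inf_less_iff by blast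
      moreover have "emeasure M {x \<in> space M. u n < ecmod (f x)}
          \<le> emeasure M {x \<in> space M. ennreal s' < ecmod (f x)}"
        using \<open>ennreal s' < u n\<close> by (intro emeasure_mono) (auto intro: less_trans)
      ultimately show "emeasure M {x \<in> space M. u n < ecmod (f x)} \<le> ennreal t" by simp
    qed
    finally show ?thesis .
  qed simp
next
  assume le: "emeasure M {x \<in> space M. s < ecmod (f x)} \<le> ennreal t"
  show "rearrangement M f t \<le> s"
  proof (cases s)
    case (real r)
    with le show ?thesis unfolding rearrangement_def by (auto intro!: Inf_lower)
  qed simp
qed

lemma rearrangement_mono_AE:
  assumes [measurable]: "(\<lambda>x. ecmod (f x)) \<in> borel_measurable M"
    "(\<lambda>x. ecmod (g x)) \<in> borel_measurable M"
    and le: "AE x in M. ecmod (f x) \<le> ecmod (g x)"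
  shows "rearrangement M f t \<le> rearrangement M g t"
  unfolding rearrangement_le_iff[OF assms(1)]
proof (rule order_trans)
  show "emeasure M {x \<in> space M. rearrangement M g t < ecmod (g x)} \<le> ennreal t"
    by (simp flip: rearrangement_le_iff)
qed (use le in \<open>auto intro!: emeasure_mono_AE elim!: eventually_mono\<close>)

lemma rearrangement_antimono:
  assumes [measurable]: "(\<lambda>x. ecmod (f x)) \<in> borel_measurable M" and "s \<le> t"
  shows "rearrangement M f t \<le> rearrangement M f s"
  unfolding rearrangement_le_iff[OF assms(1)]
  using rearrangement_le_iff[OF assms(1), of s "rearrangement M f s"] ennreal_leI[OF assms(2)]
  by (simp add: order_trans)

text \<open>On the half-line, f*(t) > s holds exactly when t < \<mu>{|f| > s}, so the superlevel
  sets of f* are intervals.\<close>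

lemma borel_measurable_rearrangement:
  assumes [measurable]: "(\<lambda>x. ecmod (f x)) \<in> borel_measurable M"
  shows "rearrangement M f \<in> borel_measurable half_line"
proof (rule borel_measurableI_greater)
  fix s :: ennreal
  have "{t. ennreal t < emeasure M {x \<in> space M. s < ecmod (f x)}} \<in> sets borel"
    by measurable
  then have "{0<..} \<inter> {t. ennreal t < emeasure M {x \<in> space M. s < ecmod (f x)}} \<in> sets half_line"
    by (auto simp: sets_restrict_space)
  also have "{0<..} \<inter> {t. ennreal t < emeasure M {x \<in> space M. s < ecmod (f x)}} =
    {t \<in> space half_line. s < rearrangement M f t}"
    by (auto simp: space_restrict_space rearrangement_le_iff simp flip: not_le)
  finally show "{t \<in> space half_line. s < rearrangement M f t} \<in> sets half_line" .
qed

lemma rearrangement_scale: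
  assumes [measurable]: "f \<in> borel_measurable M" and "0 < a"
  shows "rearrangement M (to_M (\<lambda>x. ennreal a * f x)) t = ennreal a * rearrangement M (to_M f) t"
proof -
  \<comment> \<open>Stated for all f and a, because the reverse inequality is the same bound for a f
    and the scalar 1/a.\<close>
  have le: "rearrangement M (to_M (\<lambda>x. ennreal a * f x)) t \<le> ennreal a * rearrangement M (to_M f) t"
    if [measurable]: "f \<in> borel_measurable M" for f and a
  proof (subst rearrangement_le_iff)
    let ?R = "rearrangement M (to_M f) t"
    have "emeasure M {x \<in> space M. ennreal a * ?R < ecmod (to_M (\<lambda>x. ennreal a * f x) x)}
        \<le> emeasure M {x \<in> space M. ?R < f x}"
      by (rule emeasure_mono) (auto intro: mult_left_mono simp flip: not_le)
    also have "\<dots> \<le> ennreal t"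
      using rearrangement_le_iff[of "to_M f" M t ?R] by simp
    finally show "emeasure M {x \<in> space M. ennreal a * ?R < ecmod (to_M (\<lambda>x. ennreal a * f x) x)} \<le> ennreal t" .
  qed simp
  have inv: "ennreal a * (ennreal (1 / a) * x) = x" "ennreal (1 / a) * (ennreal a * x) = x" for x
    using assms(2) by (simp_all add: mult.assoc[symmetric] flip: ennreal_mult)
  have "ennreal a * rearrangement M (to_M f) t
      \<le> ennreal a * (ennreal (1 / a) * rearrangement M (to_M (\<lambda>x. ennreal a * f x)) t)"
    using le[of "\<lambda>x. ennreal a * f x" "1 / a"] assms(2) by (intro mult_left_mono) (auto simp: inv)
  then show ?thesis using le[OF assms(1)] by (intro antisym) (auto simp: inv)
qed

text \<open>Where f + g exceeds f*(t/2) + g*(t/2), one summand exceeds its own level; each of these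
  two sets has measure at most t/2.\<close>

lemma rearrangement_add_le:
  assumes [measurable]: "f \<in> borel_measurable M" "g \<in> borel_measurable M" and "0 \<le> t"
  shows "rearrangement M (to_M (\<lambda>x. f x + g x)) t
    \<le> rearrangement M (to_M f) (t / 2) + rearrangement M (to_M g) (t / 2)" (is "_ \<le> ?a + ?b")
proof (subst rearrangement_le_iff)
  have "emeasure M {x \<in> space M. ?a + ?b < ecmod (to_M (\<lambda>x. f x + g x) x)}
      \<le> emeasure M ({x \<in> space M. ?a < f x} \<union> {x \<in> space M. ?b < g x})"
    by (rule emeasure_mono) (auto simp: not_less intro: add_mono simp flip: not_le)
  also have "\<dots> \<le> emeasure M {x \<in> space M. ?a < f x} + emeasure M {x \<in> space M. ?b < g x}"
    by (rule emeasure_subadditive) measurable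
  also have "\<dots> \<le> ennreal (t / 2) + ennreal (t / 2)"
    using rearrangement_le_iff[of "to_M f" M "t / 2" ?a] rearrangement_le_iff[of "to_M g" M "t / 2" ?b]
    by (intro add_mono) auto
  also have "\<dots> = ennreal t" using assms(3) by (simp flip: ennreal_plus)
  finally show "emeasure M {x \<in> space M. ?a + ?b < ecmod (to_M (\<lambda>x. f x + g x) x)} \<le> ennreal t" .
qed simp

lemma rearrangement_SUP:
  assumes F [measurable]: "\<And>n::nat. F n \<in> borel_measurable M" and [measurable]: "f \<in> borel_measurable M"
    and lim: "AE x in M. incseq (\<lambda>n. F n x) \<and> (\<lambda>n. F n x) \<longlonglongrightarrow> f x"
  shows "incseq (\<lambda>n. rearrangement M (to_M (F n)) t)"
    and "rearrangement M (to_M f) t = (SUP n. rearrangement M (to_M (F n)) t)"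
proof -
  have le_f: "AE x in M. F n x \<le> f x" for n
    using lim by eventually_elim (auto intro: incseq_le)
  have le_F: "AE x in M. F m x \<le> F n x" if "m \<le> n" for m n
    using lim by eventually_elim (use that in \<open>auto simp: incseq_def\<close>)
  show inc: "incseq (\<lambda>n. rearrangement M (to_M (F n)) t)"
    unfolding incseq_def using le_F by (auto intro!: rearrangement_mono_AE)
  show "rearrangement M (to_M f) t = (SUP n. rearrangement M (to_M (F n)) t)" (is "_ = ?S")
  proof (rule antisym)
    show "?S \<le> rearrangement M (to_M f) t"
      using le_f by (intro SUP_least rearrangement_mono_AE) auto
    \<comment> \<open>The sequence increases only almost everywhere. The running maxima over k <= n
      increase at every point and agree with \<open>F n\<close> almost everywhere, so continuity
      from below applies to their superlevel sets.\<close>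
    have "emeasure M {x \<in> space M. ?S < f x} = emeasure M (\<Union>n. {x \<in> space M. ?S < Sup ((\<lambda>k. F k x) ` {..n})})"
    proof (rule emeasure_eq_AE)
      show "AE x in M. x \<in> {x \<in> space M. ?S < f x} \<longleftrightarrow>
          x \<in> (\<Union>n. {x \<in> space M. ?S < Sup ((\<lambda>k. F k x) ` {..n})})"
        using lim
      proof eventually_elim
        case (elim x)
        then have "f x = (SUP n. F n x)" by (metis LIMSEQ_SUP LIMSEQ_unique)
        then show ?case by (auto simp: less_SUP_iff)
      qed
    qed measurable
    also have "\<dots> = (SUP n. emeasure M {x \<in> space M. ?S < Sup ((\<lambda>k. F k x) ` {..n})})"
      by (rule SUP_emeasure_incseq[symmetric])
         (auto simp: incseq_def less_SUP_iff intro: order_trans)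
    also have "\<dots> \<le> ennreal t"
    proof (rule SUP_least)
      fix n
      have "emeasure M {x \<in> space M. ?S < Sup ((\<lambda>k. F k x) ` {..n})} = emeasure M {x \<in> space M. ?S < F n x}"
      proof (rule emeasure_eq_AE)
        show "AE x in M. x \<in> {x \<in> space M. ?S < Sup ((\<lambda>k. F k x) ` {..n})} \<longleftrightarrow>
            x \<in> {x \<in> space M. ?S < F n x}"
          using lim by eventually_elim (auto simp: less_SUP_iff incseq_def dest: order.strict_trans2)
      qed measurable
      also have "\<dots> \<le> ennreal t"
        using rearrangement_le_iff[of "to_M (F n)" M t ?S] by (auto intro: SUP_upper)
      finally show "emeasure M {x \<in> space M. ?S < Sup ((\<lambda>k. F k x) ` {..n})} \<le> ennreal t" .
    qed
    finally show "rearrangement M (to_M f) t \<le> ?S"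
      by (subst rearrangement_le_iff) auto
  qed
qed

text \<open>A measure bounded by every t > 0 vanishes, so the values of f* on the open half-line
  already decide whether f = 0 almost everywhere.\<close>

lemma rearrangement_eq_0_AE_iff:
  assumes [measurable]: "(\<lambda>x. ecmod (f x)) \<in> borel_measurable M"
  shows "(AE x in M. ecmod (f x) = 0) \<longleftrightarrow> (\<forall>t>0. rearrangement M f t = 0)"
proof -
  have "(AE x in M. ecmod (f x) = 0) \<longleftrightarrow> emeasure M {x \<in> space M. 0 < ecmod (f x)} = 0"
    by (subst AE_iff_measurable[OF _ refl]) (auto simp: zero_less_iff_neq_zero)
  also have "\<dots> \<longleftrightarrow> (\<forall>t>0. emeasure M {x \<in> space M. 0 < ecmod (f x)} \<le> ennreal t)"
    using ennreal_le_epsilon[of 0 "emeasure M {x \<in> space M. 0 < ecmod (f x)}"] by auto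
  also have "\<dots> \<longleftrightarrow> (\<forall>t>0. rearrangement M f t \<le> 0)"
    by (simp only: rearrangement_le_iff[OF assms])
  finally show ?thesis by simp
qed

section \<open>Slowly varying functions\<close>

lemma equiv_posE:
  assumes "equiv_pos f g"
  obtains c C where "0 < c" "0 < C" "\<And>t. 0 < t \<Longrightarrow> c * g t \<le> f t" "\<And>t. 0 < t \<Longrightarrow> f t \<le> C * g t"
  using assms unfolding equiv_pos_def by blast

text \<open>Take \<epsilon> = 1: the function b(t)/t is non-increasing up to constants, so its value
  at t is controlled by its value at t/2. The constant is C/c from the two-sided estimate, times 2
  from the ratio of t to t/2.\<close>

lemma slowly_varying_dilation:
  assumes "slowly_varying b"
  obtains K where "0 < K" and "\<And>t. 0 < t \<Longrightarrow> b t \<le> K * b (t / 2)"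
proof -
  obtain b2 where b2: "antimono_on {0<..} b2" "equiv_pos (\<lambda>t. t powr (-1) * b t) b2"
    using assms unfolding slowly_varying_def by (metis zero_less_one)
  from b2(2) obtain c C where c: "0 < c" "0 < C"
    and lo: "\<And>t. 0 < t \<Longrightarrow> c * b2 t \<le> t powr (-1) * b t"
    and hi: "\<And>t. 0 < t \<Longrightarrow> t powr (-1) * b t \<le> C * b2 t"
    by (rule equiv_posE) blast
  have "b t \<le> (2 * C / c) * b (t / 2)" if t: "0 < t" for t
  proof -
    have "b2 t \<le> b2 (t / 2)"
      using t by (intro monotone_onD[OF b2(1)]) auto
    then have "C * b2 t \<le> C / c * (c * b2 (t / 2))" using c by simp
    also have "\<dots> \<le> C / c * ((t / 2) powr (-1) * b (t / 2))"
      using c t by (intro mult_left_mono lo) auto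
    finally have "t powr (-1) * b t \<le> C / c * ((t / 2) powr (-1) * b (t / 2))"
      using hi[OF t] by linarith
    then have "t * (t powr (-1) * b t) \<le> t * (C / c * ((t / 2) powr (-1) * b (t / 2)))"
      using t by (intro mult_left_mono) auto
    moreover have "t * (t powr (-1) * b t) = b t"
      "t * (C / c * ((t / 2) powr (-1) * b (t / 2))) = 2 * C / c * b (t / 2)"
      using t c by (simp_all add: powr_minus field_simps)
    ultimately show ?thesis by simp
  qed
  then show ?thesis using c by (intro that[of "2 * C / c"]) auto
qed

text \<open>The function t^\<epsilon> b(t) is non-decreasing up to constants, so its behaviour at
  \<open>m\<close> bounds it on (0,m].\<close>

lemma slowly_varying_powr_bounded:
  assumes "slowly_varying b" and "0 < \<epsilon>" and "0 < m"
  obtains D where "0 < D" and "\<And>t. 0 < t \<Longrightarrow> t \<le> m \<Longrightarrow> t powr \<epsilon> * b t \<le> D"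
proof -
  obtain b1 where b1: "mono_on {0<..} b1" "equiv_pos (\<lambda>t. t powr \<epsilon> * b t) b1"
    using assms(1,2) unfolding slowly_varying_def by metis
  from b1(2) obtain c C where c: "0 < C"
    and hi: "\<And>t. 0 < t \<Longrightarrow> t powr \<epsilon> * b t \<le> C * b1 t"
    by (rule equiv_posE) blast
  have le: "t powr \<epsilon> * b t \<le> C * b1 m" if "0 < t" "t \<le> m" for t
    using hi[OF that(1)] monotone_onD[OF b1(1), of t m] that c
    by (smt (verit) greaterThan_iff mult_left_mono)
  moreover have "0 < m powr \<epsilon> * b m"
    using assms(1,3) by (simp add: slowly_varying_def)
  ultimately show ?thesis using assms(3) by (intro that[of "C * b1 m"]) force+
qed

section \<open>Lorentz--Karamata functionals\<close>

lemma slowly_varying_pos: "slowly_varying b \<Longrightarrow> 0 < t \<Longrightarrow> 0 < b t"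
  by (simp add: slowly_varying_def)

section \<open>Finiteness of the weight near the origin\<close>

lemma borel_measurable_LK_weight:
  assumes "slowly_varying b"
  shows "(\<lambda>t. ennreal (t powr a * b t)) \<in> borel_measurable half_line"
proof -
  have [measurable]: "b \<in> borel_measurable half_line"
    using assms by (simp add: slowly_varying_def)
  have "(\<lambda>t::real. t powr a) \<in> borel_measurable lebesgue"
    by (intro measurable_completion) measurable
  then have [measurable]: "(\<lambda>t::real. t powr a) \<in> borel_measurable half_line"
    by (rule measurable_restrict_space1)
  show ?thesis by measurable
qed

lemma AE_half_lineI: "(\<And>t. 0 < t \<Longrightarrow> P t) \<Longrightarrow> AE t in half_line. P t"
  by (rule AE_I2) (simp add: space_restrict_space)

lemma nn_integral_powr_half_line_finite:
  assumes "-1 < a" and "0 \<le> m"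
  shows "(\<integral>\<^sup>+t. ennreal (t powr a) * indicator {..m} t \<partial>half_line) < \<infinity>"
proof -
  have "(\<integral>\<^sup>+t. ennreal (t powr a) * indicator {..m} t \<partial>half_line)
      = (\<integral>\<^sup>+t. (ennreal (t powr a) * indicator {..m} t) * indicator {0<..} t \<partial>lborel)"
    by (simp add: nn_integral_restrict_space nn_integral_completion)
  also have "\<dots> \<le> (\<integral>\<^sup>+t. ennreal (t powr a) * indicator {0..m} t \<partial>lborel)"
    by (intro nn_integral_mono) (auto simp: indicator_def)
  also have "\<dots> = ennreal (m powr (a + 1) / (a + 1))"
    using nn_integral_has_integral_lebesgue'[OF _ has_integral_powr_from_0[OF assms]] by simp
  finally show ?thesis by (simp add: le_less_trans)
qed

text \<open>The q-th power of the integrand is t^(\<epsilon> q - 1), whose exponent exceeds -1. For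
  infinite \<open>q\<close> the supremum is bounded by m^\<epsilon>.\<close>

lemma Lq_norm_powr_finite:
  assumes "0 < q" and "0 < \<epsilon>" and "0 < m"
  shows "Lq_norm q (\<lambda>t. ennreal (t powr (\<epsilon> - recip q)) * indicator {..m} t) < \<infinity>"
proof (cases "q = \<infinity>")
  case True
  have "(\<lambda>t::real. ennreal (t powr \<epsilon>) * indicator {..m} t) \<in> borel_measurable half_line"
    by (intro measurable_restrict_space1 measurable_completion) measurable
  then have "Lq_norm q (\<lambda>t. ennreal (t powr (\<epsilon> - recip q)) * indicator {..m} t) \<le> ennreal (m powr \<epsilon>)"
    using assms True by (subst Lq_norm_le_iff)
      (auto intro!: AE_half_lineI ennreal_leI powr_mono2 simp: indicator_def)
  then show ?thesis by (simp add: le_less_trans)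
next
  case False
  then have q: "0 < enn2real q" using assms(1) by (rule enn2real_exponent_pos[rotated])
  have "ennpowr (ennreal (t powr (\<epsilon> - recip q)) * indicator {..m} t) (enn2real q)
      = ennreal (t powr (\<epsilon> * enn2real q - 1)) * indicator {..m} t" for t
    using q False assms(1)
    by (auto simp: indicator_def ennpowr_ennreal powr_powr recip_eq left_diff_distrib)
  then show ?thesis
    using nn_integral_powr_half_line_finite[of "\<epsilon> * enn2real q - 1" m] assms q False
    by (simp add: Lq_norm_def ennpowr_less_top_iff)
qed

text \<open>The exponent \<open>a\<close> is halved: t^(a/2) b(t) is bounded on (0,m], and the other
  half leaves a pure power with finite norm near 0.\<close>

lemma Lq_norm_weight_finite:
  assumes "0 < q" and sv: "slowly_varying b" and "0 < a" and "0 < m"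
  shows "Lq_norm q (\<lambda>t. ennreal (t powr (a - recip q) * b t) * indicator {..m} t) < \<infinity>"
proof -
  obtain D where D: "0 < D" "\<And>t. 0 < t \<Longrightarrow> t \<le> m \<Longrightarrow> t powr (a / 2) * b t \<le> D"
    using slowly_varying_powr_bounded[OF sv, of "a / 2" m] assms by auto
  note [measurable] = borel_measurable_LK_weight[OF sv]
  let ?g = "\<lambda>t. ennreal (t powr (a / 2 - recip q)) * indicator {..m} t"
  have [measurable]: "(\<lambda>t::real. indicator {..m} t :: ennreal) \<in> borel_measurable half_line"
    "(\<lambda>t::real. ennreal (t powr (a / 2 - recip q))) \<in> borel_measurable half_line"
    by (intro measurable_restrict_space1 measurable_completion; measurable)+
  have "Lq_norm q (\<lambda>t. ennreal (t powr (a - recip q) * b t) * indicator {..m} t)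
      \<le> Lq_norm q (\<lambda>t. ennreal D * ?g t)"
  proof (intro Lq_norm_mono AE_half_lineI assms(1))
    fix t :: real assume t: "0 < t"
    show "ennreal (t powr (a - recip q) * b t) * indicator {..m} t \<le> ennreal D * ?g t"
    proof (cases "t \<le> m")
      case True
      have "t powr (a - recip q) * b t = t powr (a / 2 - recip q) * (t powr (a / 2) * b t)"
        by (simp flip: powr_add)
      also have "\<dots> \<le> t powr (a / 2 - recip q) * D"
        using D t True by (intro mult_left_mono) auto
      finally show ?thesis using True D(1)
        by (simp add: ac_simps ennreal_leI flip: ennreal_mult)
    qed simp
  qed measurable
  also have "\<dots> \<le> ennreal D * Lq_norm q ?g"
    by (intro Lq_norm_cmult_le assms(1)) measurable
  also have "\<dots> < \<infinity>"
    using Lq_norm_powr_finite[of q "a / 2" m] assms by (simp add: ennreal_mult_less_top)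
  finally show ?thesis .
qed

text \<open>Away from the origin \<open>b t\<close> is bounded by a multiple of \<open>t * b t\<close>, so the
  exponent may be raised to a positive one.\<close>

lemma Lq_norm_weight_finite_extend:
  assumes "0 < q" and sv: "slowly_varying b" and "0 < \<delta>" and "0 < m"
    and fin: "Lq_norm q (\<lambda>t. ennreal (t powr (- recip q) * b t) * indicator {..\<delta>} t) < \<infinity>"
  shows "Lq_norm q (\<lambda>t. ennreal (t powr (- recip q) * b t) * indicator {..m} t) < \<infinity>"
proof -
  note [measurable] = borel_measurable_LK_weight[OF sv]
  have [measurable]: "(\<lambda>t::real. indicator {..m} t :: ennreal) \<in> borel_measurable half_line" for m
    by (intro measurable_restrict_space1 measurable_completion) measurable
  let ?w = "\<lambda>t. ennreal (t powr (- recip q) * b t)"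
  let ?v = "\<lambda>t. ennreal (t powr (1 - recip q) * b t)"
  obtain C where C: "C < \<infinity>" and add: "\<And>g h. g \<in> borel_measurable half_line \<Longrightarrow> h \<in> borel_measurable half_line \<Longrightarrow>
    Lq_norm q (\<lambda>t. g t + h t) \<le> C * (Lq_norm q g + Lq_norm q h)"
    using Lq_norm_add[OF assms(1)] by blast
  have "Lq_norm q (\<lambda>t. ?w t * indicator {..m} t)
      \<le> Lq_norm q (\<lambda>t. ?w t * indicator {..\<delta>} t + ennreal (1 / \<delta>) * (?v t * indicator {..m} t))"
  proof (intro Lq_norm_mono AE_half_lineI assms(1))
    fix t :: real assume t: "0 < t"
    have "?w t \<le> ennreal (1 / \<delta>) * ?v t" if "\<delta> < t"
    proof -
      have "1 * (t powr (- recip q) * b t) \<le> (t / \<delta>) * (t powr (- recip q) * b t)"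
        using that assms(3) slowly_varying_pos[OF sv t] by (intro mult_right_mono) (auto simp: less_imp_le)
      also have "\<dots> = 1 / \<delta> * (t powr (1 - recip q) * b t)"
        using t by (simp add: powr_diff powr_minus field_simps)
      finally show ?thesis using assms(3) slowly_varying_pos[OF sv t]
        by (simp add: ennreal_leI flip: ennreal_mult)
    qed
    then show "?w t * indicator {..m} t
      \<le> ?w t * indicator {..\<delta>} t + ennreal (1 / \<delta>) * (?v t * indicator {..m} t)"
      by (cases "t \<le> \<delta>") (auto simp: indicator_def)
  qed measurable
  also have "\<dots> \<le> C * (Lq_norm q (\<lambda>t. ?w t * indicator {..\<delta>} t) +
      Lq_norm q (\<lambda>t. ennreal (1 / \<delta>) * (?v t * indicator {..m} t)))"
    by (rule add) measurable
  also have "\<dots> \<le> C * (Lq_norm q (\<lambda>t. ?w t * indicator {..\<delta>} t) +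
      ennreal (1 / \<delta>) * Lq_norm q (\<lambda>t. ?v t * indicator {..m} t))"
    by (intro mult_left_mono add_left_mono Lq_norm_cmult_le assms(1)) measurable
  also have "\<dots> < \<infinity>"
    using C fin Lq_norm_weight_finite[OF assms(1) sv, of 1 m] assms(4)
    by (simp add: ennreal_mult_less_top)
  finally show ?thesis .
qed

section \<open>The axioms other than (P4)\<close>

locale Lorentz_Karamata =
  fixes M :: "'a measure" and p q :: ennreal and b :: "real \<Rightarrow> real"
  assumes q_pos: "0 < q" and slowly_varying: "slowly_varying b"
begin

definition w :: "real \<Rightarrow> ennreal" where
  "w t = ennreal (t powr (recip p - recip q) * b t)"

lemma LK_norm_eq: "LK_norm M p q b f = Lq_norm q (\<lambda>t. w t * rearrangement M f t)"
  by (simp add: LK_norm_def w_def)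

lemma borel_measurable_w [measurable]: "w \<in> borel_measurable half_line"
  unfolding w_def[abs_def] by (rule borel_measurable_LK_weight[OF slowly_varying])

lemma w_pos: "0 < t \<Longrightarrow> 0 < w t"
  using slowly_varying_pos[OF slowly_varying] by (simp add: w_def)

lemma w_dilation: obtains K where "0 < K" "\<And>t. 0 < t \<Longrightarrow> w t \<le> ennreal K * w (t / 2)"
proof -
  let ?a = "recip p - recip q"
  obtain K where K: "0 < K" "\<And>t. 0 < t \<Longrightarrow> b t \<le> K * b (t / 2)"
    using slowly_varying_dilation[OF slowly_varying] by blast
  have "w t \<le> ennreal (2 powr ?a * K) * w (t / 2)" if t: "0 < t" for t
  proof -
    have scale: "t powr ?a = 2 powr ?a * (t / 2) powr ?a"
      using t by (simp flip: powr_mult)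
    have "t powr ?a * b t \<le> t powr ?a * (K * b (t / 2))"
      using K t by (intro mult_left_mono) auto
    also have "\<dots> = (2 powr ?a * K) * ((t / 2) powr ?a * b (t / 2))"
      unfolding scale by simp
    finally have "w t \<le> ennreal ((2 powr ?a * K) * ((t / 2) powr ?a * b (t / 2)))"
      unfolding w_def by (rule ennreal_leI)
    then show ?thesis using K(1) by (simp add: w_def ennreal_mult')
  qed
  then show ?thesis using K(1) by (intro that[of "2 powr ?a * K"]) auto
qed

lemma borel_measurable_w_rearrangement:
  assumes "(\<lambda>x. ecmod (f x)) \<in> borel_measurable M"
  shows "(\<lambda>t. w t * rearrangement M f t) \<in> borel_measurable half_line"
  using borel_measurable_rearrangement[OF assms] by measurable

lemma LK_norm_mono:
  assumes [measurable]: "(\<lambda>x. ecmod (f x)) \<in> borel_measurable M" "(\<lambda>x. ecmod (g x)) \<in> borel_measurable M"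
    and "AE x in M. ecmod (f x) \<le> ecmod (g x)"
  shows "LK_norm M p q b f \<le> LK_norm M p q b g"
  unfolding LK_norm_eq using q_pos borel_measurable_w_rearrangement[OF assms(1)]
  by (rule Lq_norm_mono) (intro AE_half_lineI mult_left_mono rearrangement_mono_AE[OF assms], simp)

lemma LK_norm_scale:
  assumes [measurable]: "f \<in> borel_measurable M" and "0 \<le> a"
  shows "LK_norm M p q b (to_M (\<lambda>x. ennreal a * f x)) = ennreal a * LK_norm M p q b (to_M f)"
proof (cases "a = 0")
  case True
  have "\<forall>t>0. rearrangement M (to_M (\<lambda>x. 0)) t = 0"
    by (subst rearrangement_eq_0_AE_iff[symmetric]) auto
  then have "LK_norm M p q b (to_M (\<lambda>x. 0)) = 0"
    using q_pos unfolding LK_norm_eq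
    by (subst Lq_norm_eq_0_iff) (auto simp: borel_measurable_w_rearrangement intro!: AE_half_lineI)
  then show ?thesis using True by simp
next
  case False
  then have "0 < a" using assms(2) by simp
  then show ?thesis unfolding LK_norm_eq
    using Lq_norm_cmult[of q "\<lambda>t. w t * rearrangement M (to_M f) t" a] q_pos
      borel_measurable_w_rearrangement[of "to_M f"]
    by (simp add: rearrangement_scale mult.left_commute)
qed

lemma LK_norm_eq_0_iff:
  assumes [measurable]: "(\<lambda>x. ecmod (f x)) \<in> borel_measurable M"
  shows "LK_norm M p q b f = 0 \<longleftrightarrow> (AE x in M. ecmod (f x) = 0)"
proof
  assume "AE x in M. ecmod (f x) = 0"
  then show "LK_norm M p q b f = 0"
    using q_pos unfolding LK_norm_eq rearrangement_eq_0_AE_iff[OF assms]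
    by (subst Lq_norm_eq_0_iff) (auto simp: borel_measurable_w_rearrangement intro!: AE_half_lineI)
next
  assume "LK_norm M p q b f = 0"
  then have "AE t in half_line. w t * rearrangement M f t = 0"
    unfolding LK_norm_eq using q_pos
    by (subst (asm) Lq_norm_eq_0_iff) (auto simp: borel_measurable_w_rearrangement)
  then have ae: "AE t in lebesgue. 0 < t \<longrightarrow> rearrangement M f t = 0"
    by (subst (asm) AE_restrict_space_iff) (auto elim!: eventually_mono dest: w_pos)
  show "AE x in M. ecmod (f x) = 0"
    unfolding rearrangement_eq_0_AE_iff[OF assms]
  proof (intro allI impI)
    fix t :: real assume t: "0 < t"
    \<comment> \<open>So far f* vanishes only at almost every point. The interval (0,t) has positive
      measure, hence contains a zero of f*, and monotonicity carries it to t.\<close>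
    have "\<exists>s\<in>{0<..<t}. rearrangement M f s = 0"
    proof (rule ccontr)
      assume none: "\<not> ?thesis"
      from ae have "AE s in lebesgue. s \<notin> {0<..<t}"
        by eventually_elim (use none in auto)
      then have "{0<..<t} \<in> null_sets lebesgue"
        by (subst AE_iff_null_sets) auto
      then show False using t by (simp add: null_sets_def)
    qed
    then obtain s where "0 < s" "s < t" "rearrangement M f s = 0" by auto
    then show "rearrangement M f t = 0"
      using rearrangement_antimono[OF assms, of s t] by simp
  qed
qed

lemma LK_norm_add:
  obtains C where "C < \<infinity>" and "\<And>f g. f \<in> borel_measurable M \<Longrightarrow> g \<in> borel_measurable M \<Longrightarrow>
    LK_norm M p q b (to_M (\<lambda>x. f x + g x)) \<le> C * (LK_norm M p q b (to_M f) + LK_norm M p q b (to_M g))"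
proof -
  obtain K where K: "0 < K" "\<And>t. 0 < t \<Longrightarrow> w t \<le> ennreal K * w (t / 2)"
    by (rule w_dilation) blast
  obtain C where C: "C < \<infinity>" and add: "\<And>g h. g \<in> borel_measurable half_line \<Longrightarrow> h \<in> borel_measurable half_line \<Longrightarrow>
    Lq_norm q (\<lambda>t. g t + h t) \<le> C * (Lq_norm q g + Lq_norm q h)"
    using Lq_norm_add[OF q_pos] by blast
  let ?D = "ennpowr 2 (recip q)"
  have "LK_norm M p q b (to_M (\<lambda>x. f x + g x))
      \<le> (ennreal K * (?D * C)) * (LK_norm M p q b (to_M f) + LK_norm M p q b (to_M g))"
    if [measurable]: "f \<in> borel_measurable M" "g \<in> borel_measurable M" for f g
  proof -
    let ?f = "rearrangement M (to_M f)" and ?g = "rearrangement M (to_M g)"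
    \<comment> \<open>Once the weight is also moved to t/2, at the cost of \<open>K\<close>, the
      whole integrand is \<open>?h\<close> at t/2. A single dilation then returns to
      \<open>?h\<close>, before the quasi-triangle inequality splits it.\<close>
    let ?h = "\<lambda>t. w t * ?f t + w t * ?g t"
    have f [measurable]: "(\<lambda>t. w t * ?f t) \<in> borel_measurable half_line"
      and g [measurable]: "(\<lambda>t. w t * ?g t) \<in> borel_measurable half_line"
      using that by (auto intro!: borel_measurable_w_rearrangement)
    have [measurable]: "?h \<in> borel_measurable half_line" by measurable
    have [measurable]: "(\<lambda>t. ?h (t / 2)) \<in> borel_measurable half_line"
      by (rule borel_measurable_half_line_dilation) measurable
    have "LK_norm M p q b (to_M (\<lambda>x. f x + g x)) \<le> Lq_norm q (\<lambda>t. ennreal K * ?h (t / 2))"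
      unfolding LK_norm_eq
    proof (intro Lq_norm_mono AE_half_lineI q_pos)
      fix t :: real assume t: "0 < t"
      have "w t * rearrangement M (to_M (\<lambda>x. f x + g x)) t
          \<le> (ennreal K * w (t / 2)) * (?f (t / 2) + ?g (t / 2))"
        using t by (intro mult_mono K rearrangement_add_le) auto
      then show "w t * rearrangement M (to_M (\<lambda>x. f x + g x)) t \<le> ennreal K * ?h (t / 2)"
        by (simp add: distrib_left mult.assoc)
    qed (use that in \<open>auto intro!: borel_measurable_w_rearrangement\<close>)
    also have "\<dots> \<le> ennreal K * Lq_norm q (\<lambda>t. ?h (t / 2))"
      by (intro Lq_norm_cmult_le q_pos) measurable
    also have "\<dots> \<le> ennreal K * (?D * Lq_norm q ?h)"
      by (intro mult_left_mono Lq_norm_dilation_le q_pos) auto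
    also have "\<dots> \<le> ennreal K * (?D * (C * (Lq_norm q (\<lambda>t. w t * ?f t) + Lq_norm q (\<lambda>t. w t * ?g t))))"
      by (intro mult_left_mono add) auto
    finally show ?thesis by (simp add: LK_norm_eq mult.assoc)
  qed
  moreover have "ennreal K * (?D * C) < \<infinity>"
    using C ennpowr_less_top_iff[of 2 "recip q"] by (simp add: ennreal_mult_less_top)
  ultimately show ?thesis using that by blast
qed

lemma LK_norm_Fatou:
  assumes F [measurable]: "\<And>n::nat. F n \<in> borel_measurable M" and [measurable]: "f \<in> borel_measurable M"
    and lim: "AE x in M. incseq (\<lambda>n. F n x) \<and> (\<lambda>n. F n x) \<longlonglongrightarrow> f x"
  shows "incseq (\<lambda>n. LK_norm M p q b (to_M (F n)))"
    and "(\<lambda>n. LK_norm M p q b (to_M (F n))) \<longlonglongrightarrow> LK_norm M p q b (to_M f)"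
proof -
  note rearr = rearrangement_SUP[OF assms]
  show inc: "incseq (\<lambda>n. LK_norm M p q b (to_M (F n)))"
    unfolding LK_norm_eq incseq_def using rearr(1) q_pos
    by (auto intro!: Lq_norm_mono mult_left_mono borel_measurable_w_rearrangement simp: incseq_def)
  have "LK_norm M p q b (to_M f) = (SUP n. LK_norm M p q b (to_M (F n)))"
    unfolding LK_norm_eq rearr(2) SUP_mult_left_ennreal using q_pos rearr(1)
    by (intro Lq_norm_SUP) (auto simp: incseq_def intro!: mult_left_mono borel_measurable_w_rearrangement)
  then show "(\<lambda>n. LK_norm M p q b (to_M (F n))) \<longlonglongrightarrow> LK_norm M p q b (to_M f)"
    using LIMSEQ_SUP[OF inc] by simp
qed

section \<open>Axiom (P4) and the finiteness of the weight\<close>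

lemma borel_measurable_w_cut [measurable]: "(\<lambda>t. w t * indicator {..m} t) \<in> borel_measurable half_line"
proof -
  have [measurable]: "(\<lambda>t::real. indicator {..m} t :: ennreal) \<in> borel_measurable half_line"
    by (intro measurable_restrict_space1 measurable_completion) measurable
  show ?thesis by measurable
qed

lemma LK_norm_indicator_finite:
  assumes fin: "\<And>m. 0 < m \<Longrightarrow> Lq_norm q (\<lambda>t. w t * indicator {..m} t) < \<infinity>"
    and [measurable]: "E \<in> sets M" and "emeasure M E < \<infinity>"
  shows "LK_norm M p q b (to_M (indicator E)) < \<infinity>"
proof -
  obtain r where r: "0 \<le> r" "emeasure M E = ennreal r"
    using assms(3) by (cases "emeasure M E") auto
  let ?f = "rearrangement M (to_M (indicator E))"
  \<comment> \<open>The rearrangement of the indicator already vanishes from t = r on. The cut at r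
    + 1 keeps the interval of positive length when E is a null set, as \<open>fin\<close>
    asks.\<close>
  have le: "?f t \<le> indicator {..r + 1} t" for t
  proof (subst rearrangement_le_iff)
    have "{x \<in> space M. indicator {..r + 1} t < ecmod (to_M (indicator E) x)} \<subseteq> (if t \<le> r + 1 then {} else E)"
      by (auto simp: indicator_def split: if_splits)
    then have "emeasure M {x \<in> space M. indicator {..r + 1} t < ecmod (to_M (indicator E) x)}
        \<le> emeasure M (if t \<le> r + 1 then {} else E)"
      by (rule emeasure_mono) simp
    also have "\<dots> \<le> ennreal t"
      using r by (auto intro: ennreal_leI)
    finally show "emeasure M {x \<in> space M. indicator {..r + 1} t < ecmod (to_M (indicator E) x)} \<le> ennreal t" .
  qed simp
  have "LK_norm M p q b (to_M (indicator E)) \<le> Lq_norm q (\<lambda>t. w t * indicator {..r + 1} t)"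
    unfolding LK_norm_eq 
    by (intro Lq_norm_mono AE_I2 mult_left_mono le q_pos borel_measurable_w_rearrangement) auto
  also have "\<dots> < \<infinity>" using r(1) by (intro fin) simp
  finally show ?thesis .
qed

lemma LK_norm_finite_weight:
  assumes [measurable]: "(\<lambda>x. ecmod (f x)) \<in> borel_measurable M"
    and "LK_norm M p q b f < \<infinity>" and "\<not> (AE x in M. ecmod (f x) = 0)"
  obtains \<delta> where "0 < \<delta>" and "Lq_norm q (\<lambda>t. w t * indicator {..\<delta>} t) < \<infinity>"
proof -
  obtain \<delta> where \<delta>: "0 < \<delta>" "rearrangement M f \<delta> \<noteq> 0"
    using assms(3) unfolding rearrangement_eq_0_AE_iff[OF assms(1)] by blast
  \<comment> \<open>The minimum with 1 keeps \<open>c\<close> finite when f*(\<delta>) is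
    infinite.\<close>
  define c where "c = enn2real (min 1 (rearrangement M f \<delta>))"
  have c: "0 < c" "ennreal c \<le> rearrangement M f \<delta>"
    using \<delta>(2) by (cases "rearrangement M f \<delta>"; auto simp: c_def min_def)+
  have "ennreal c * Lq_norm q (\<lambda>t. w t * indicator {..\<delta>} t) = Lq_norm q (\<lambda>t. ennreal c * (w t * indicator {..\<delta>} t))"
    using c(1) q_pos by (subst Lq_norm_cmult) auto
  also have "\<dots> \<le> LK_norm M p q b f"
    unfolding LK_norm_eq
  proof (intro Lq_norm_mono AE_I2 q_pos)
    fix t
    have "ennreal c \<le> rearrangement M f t" if "t \<le> \<delta>"
      using c(2) rearrangement_antimono[OF assms(1) that] by (rule order_trans)
    then have "w t * (ennreal c * indicator {..\<delta>} t) \<le> w t * rearrangement M f t"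
      by (intro mult_left_mono) (auto simp: indicator_def)
    then show "ennreal c * (w t * indicator {..\<delta>} t) \<le> w t * rearrangement M f t"
      by (simp add: ac_simps)
  qed measurable
  finally have "ennreal c * Lq_norm q (\<lambda>t. w t * indicator {..\<delta>} t) < \<infinity>"
    using assms(2) by (rule le_less_trans)
  then show ?thesis using c(1) \<delta>(1) by (intro that[of \<delta>]) (auto simp: ennreal_mult_less_top)
qed

text \<open>All other axioms having been proved, being a norm of this kind reduces to (P4).\<close>

lemma ri_quasi_Banach_function_norm_LK_iff:
  "ri_quasi_Banach_function_norm M (LK_norm M p q b) \<longleftrightarrow>
    (\<forall>E\<in>sets M. emeasure M E < \<infinity> \<longrightarrow> LK_norm M p q b (to_M (indicator E)) < \<infinity>)"
proof -
  have "LK_norm M p q b f = LK_norm M p q b (to_M (\<lambda>x. ecmod (f x)))" for f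
    by (simp add: LK_norm_def rearrangement_def)
  moreover have "\<exists>C<\<infinity>. \<forall>f\<in>M_plus M. \<forall>g\<in>M_plus M.
    LK_norm M p q b (to_M (\<lambda>x. f x + g x)) \<le> C * (LK_norm M p q b (to_M f) + LK_norm M p q b (to_M g))"
    by (rule LK_norm_add) blast
  moreover have "LK_norm M p q b (to_M f) = LK_norm M p q b (to_M g)"
    if "f \<in> M_plus M" "g \<in> M_plus M" "\<forall>t\<ge>0. rearrangement M (to_M f) t = rearrangement M (to_M g) t" for f g
    unfolding LK_norm_eq using that q_pos
    by (intro antisym Lq_norm_mono AE_half_lineI borel_measurable_w_rearrangement) auto
  moreover have "LK_norm M p q b (to_M f) = 0 \<longleftrightarrow> (AE x in M. f x = 0)" if "f \<in> M_plus M" for f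
    using LK_norm_eq_0_iff[of "to_M f"] that by simp
  moreover have "LK_norm M p q b (to_M f) \<le> LK_norm M p q b (to_M g)"
    if "f \<in> M_plus M" "g \<in> M_plus M" "AE x in M. f x \<le> g x" for f g
    using LK_norm_mono[of "to_M f" "to_M g"] that by simp
  ultimately show ?thesis
    unfolding ri_quasi_Banach_function_norm_def
    using LK_norm_scale LK_norm_Fatou by blast
qed

end

section \<open>Proof of the equivalence\<close>

lemma (in sigma_finite_measure) ex_finite_positive_emeasure:
  assumes "emeasure M (space M) \<noteq> 0"
  obtains E where "E \<in> sets M" "0 < emeasure M E" "emeasure M E < \<infinity>"
proof -
  obtain A :: "nat \<Rightarrow> 'a set" where A: "range A \<subseteq> sets M" "(\<Union>i. A i) = space M" "\<And>i. emeasure M (A i) \<noteq> \<infinity>"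
    using sigma_finite by blast
  have "\<exists>i. emeasure M (A i) \<noteq> 0"
  proof (rule ccontr)
    assume "\<nexists>i. emeasure M (A i) \<noteq> 0"
    then have "(\<Union>i. A i) \<in> null_sets M" using A(1) by (intro null_sets_UN) auto
    then show False using assms A(2) by (simp add: null_sets_def)
  qed
  then show ?thesis using that A by (metis less_top infinity_ennreal_def rangeI subsetD zero_less_iff_neq_zero)
qed

theorem proposition3p2:
  fixes M :: "'a measure" and p q :: ennreal and b :: "real \<Rightarrow> real"
  assumes "sigma_finite_measure M" and "non_atomic M" and "emeasure M (space M) = \<infinity>"
    and "0 < p" and "0 < q" and "slowly_varying b"
  defines "cond \<equiv> p < \<infinity> \<or>
    p = \<infinity> \<and> Lq_norm q (\<lambda>t. ennreal (t powr (- recip q) * b t) * indicator {0<..<1} t) < \<infinity>"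
  shows "(ri_quasi_Banach_function_norm M (LK_norm M p q b) \<longleftrightarrow> cond) \<and>
    (ri_quasi_Banach_function_space M (LK_space M p q b) (LK_norm M p q b) \<longleftrightarrow> cond) \<and>
    (\<not> cond \<longrightarrow> LK_space M p q b = {f \<in> M_fun M. AE x in M. f x = Some 0})"
proof -
  interpret Lorentz_Karamata M p q b using assms by unfold_locales
  interpret sigma_finite_measure M by fact
  have w_infty: "w = (\<lambda>t. ennreal (t powr (- recip q) * b t))" if "p = \<infinity>"
    unfolding w_def[abs_def] using that by simp
  have cond_imp: "Lq_norm q (\<lambda>t. w t * indicator {..m} t) < \<infinity>" if cond "0 < m" for m
  proof (cases "p = \<infinity>")
    case False
    then have "0 < recip p" using assms(4) by (simp add: recip_eq enn2real_exponent_pos)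
    then show ?thesis unfolding w_def using assms that by (intro Lq_norm_weight_finite) auto
  next
    case True
    \<comment> \<open>The closed cut at 1/2 lies inside (0,1) on the half-line, so the hypothesis
      applies to it; the extension lemma then reaches \<open>m\<close>.\<close>
    have "Lq_norm q (\<lambda>t. w t * indicator {..1/2} t) \<le> Lq_norm q (\<lambda>t. w t * indicator {0<..<1} t)"
      by (rule Lq_norm_mono[OF q_pos borel_measurable_w_cut])
        (auto intro!: AE_half_lineI simp: indicator_def)
    also have "\<dots> < \<infinity>" using that(1) True unfolding w_infty[OF True] cond_def by simp
    finally show ?thesis
      using Lq_norm_weight_finite_extend[of q b "1/2" m] assms(5,6) that(2) unfolding w_infty[OF True] by simp
  qed
  have imp_cond: cond if "0 < \<delta>" "Lq_norm q (\<lambda>t. w t * indicator {..\<delta>} t) < \<infinity>" for \<delta>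
  proof (cases "p = \<infinity>")
    case False
    then show ?thesis by (simp add: cond_def less_top)
  next
    case True
    have [measurable]: "(\<lambda>t::real. indicator {0<..<1} t :: ennreal) \<in> borel_measurable half_line"
      by (intro measurable_restrict_space1 measurable_completion) measurable
    have "(\<lambda>t. w t * indicator {0<..<1} t) \<in> borel_measurable half_line" by measurable
    then have "Lq_norm q (\<lambda>t. w t * indicator {0<..<1} t) \<le> Lq_norm q (\<lambda>t. w t * indicator {..1} t)"
      by (rule Lq_norm_mono[OF q_pos]) (auto intro!: AE_half_lineI simp: indicator_def)
    also have "\<dots> < \<infinity>"
      using Lq_norm_weight_finite_extend[of q b \<delta> 1] assms(5,6) that unfolding w_infty[OF True] by simp
    finally show ?thesis using True unfolding w_infty[OF True] cond_def by simp
  qed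
  have zero: "AE x in M. ecmod (f x) = 0"
    if "\<not> cond" "(\<lambda>x. ecmod (f x)) \<in> borel_measurable M" "LK_norm M p q b f < \<infinity>" for f
    using LK_norm_finite_weight[of f] that imp_cond by blast
  have norm_iff: "ri_quasi_Banach_function_norm M (LK_norm M p q b) \<longleftrightarrow> cond"
    unfolding ri_quasi_Banach_function_norm_LK_iff
  proof
    assume fin: "\<forall>E\<in>sets M. emeasure M E < \<infinity> \<longrightarrow> LK_norm M p q b (to_M (indicator E)) < \<infinity>"
    show cond
    proof (rule ccontr)
      assume "\<not> cond"
      obtain E where E [measurable]: "E \<in> sets M" and "0 < emeasure M E" "emeasure M E < \<infinity>"
        using ex_finite_positive_emeasure assms(3) by auto
      \<comment> \<open>Under (P4) the indicator of E has finite norm, but without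
        \<open>cond\<close> only the zero function does. This contradicts the positive measure of
        E.\<close>
      then have "AE x in M. (indicator E x :: ennreal) = 0"
        using zero[OF \<open>\<not> cond\<close>, of "to_M (indicator E)"] fin by simp
      then have "AE x in M. x \<notin> E" by (auto simp: indicator_def elim!: eventually_mono split: if_splits)
      then have "emeasure M E = 0"
        using AE_iff_null_sets[OF E] by (simp add: null_sets_def)
      then show False using \<open>0 < emeasure M E\<close> by simp
    qed
  qed (use cond_imp LK_norm_indicator_finite in blast)
  have "LK_space M p q b = {f \<in> M_fun M. AE x in M. f x = Some 0}" if "\<not> cond"
  proof -
    have "LK_norm M p q b f < \<infinity> \<longleftrightarrow> (AE x in M. f x = Some 0)" if "f \<in> M_fun M" for f
    proof -
      have [measurable]: "(\<lambda>x. ecmod (f x)) \<in> borel_measurable M"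
        using that by (rule measurable_compose) measurable
      show ?thesis
        using zero[OF \<open>\<not> cond\<close>, of f] LK_norm_eq_0_iff[of f] by (auto simp: ecmod_eq_0_iff)
    qed
    then show ?thesis by (auto simp: LK_space_def)
  qed
  \<comment> \<open>The statement on the space adds only the equation for its underlying set, which
    is the definition of \<open>LK_space\<close>.\<close>
  with norm_iff show ?thesis
    by (simp add: ri_quasi_Banach_function_space_def LK_space_def)
qed

end
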